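(* Let $p$ be a prime and $\lambda$ a partition. For each ideal $I\subset P_\lambda$, $|A_{p,I}|=p^{[I]}$.
   Context: A partition is a non-increasing sequence $\lambda=(\lambda_1\geq\cdots\geq\lambda_l)$ of positive integers; $A_{p,\lambda}=\mathbf{Z}/p^{\lambda_1}\mathbf{Z}\oplus\cdots\oplus\mathbf{Z}/p^{\lambda_l}\mathbf{Z}$. Fundamental poset $P$: its elements are the symbols $(p^r,k)$ with integers $0\leq r<k$, where $(p^r,k)$ denotes the orbit of $p^r$ in $\mathbf{Z}/p^k\mathbf{Z}$ under automorphisms of $\mathbf{Z}/p^k\mathbf{Z}$, i.e. the set of elements $p^ru$ with $p\nmid u$. The partial order is: $(p^r,k)\geq(p^s,l)$ if and only if $r\leq s$ and $k-r\geq l-s$ (equivalently, some homomorphism $\mathbf{Z}/p^k\mathbf{Z}\to\mathbf{Z}/p^l\mathbf{Z}$ maps $p^r$ to $p^s$). $P_\lambda$ is the induced subposet consisting of the elements $(p^r,k)$ with $k=\lambda_i$ for some $i$. An ideal of a poset is a (possibly empty) down-closed subset. For $a=(a_1,\ldots,a_l)\in A_{p,\lambda}$, $I(a)$ is the ideal of $P$ generated by the orbits of the non-zero coordinates $a_i\in\mathbf{Z}/p^{\lambda_i}\mathbf{Z}$ ($a_i=p^ru\neq0$ with $p\nmid u$ contributes $(p^r,\lambda_i)$), and $I_\lambda(a)=I(a)\cap P_\lambda$. For an ideal $I\subset P_\lambda$, $A_{p,I}=\{a\in A_{p,\lambda}: I_\lambda(a)\subset I\}$. For $x=(p^r,k)\in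 P_\lambda$, the multiplicity $m(x)$ is the number of times $k$ occurs in $\lambda$. For an ideal $I\subset P_\lambda$, $[I]=\sum_{x\in I}m(x)$. *)

theory Defs
  imports
    "HOL.Hull"
    "HOL-Algebra.Product_Groups"
    "HOL-Algebra.Group_Action"
    "HOL-Computational_Algebra.Primes"
begin

definition is_partition :: "nat list \<Rightarrow> bool" where
  "is_partition lam \<longleftrightarrow> sorted_wrt (\<ge>) lam \<and> (\<forall>k\<in>set lam. 0 < k)"

text \<open>The direct sum of the groups \<open>\<int>/p^(lam ! i)\<close>; list indices start at 0, and the elements of
  \<open>\<int>/n\<close> are the representatives \<open>0, \<dots>, n - 1\<close>.\<close>

definition fin_pgroup :: "nat \<Rightarrow> nat list \<Rightarrow> (nat \<Rightarrow> int) monoid" where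
  "fin_pgroup p lam = product_group {..<length lam} (\<lambda>i. integer_mod_group (p ^ (lam ! i)))"

text \<open>The symbol \<open>(p\<^sup>r, k)\<close> is encoded as the pair \<open>(r, k)\<close>; \<open>symbol_orbit p\<close> gives the orbit
  that it denotes.\<close>

definition fund_poset :: "(nat \<times> nat) set" where
  "fund_poset = {(r, k). r < k}"

definition symbol_orbit :: "nat \<Rightarrow> nat \<times> nat \<Rightarrow> int set" where
  "symbol_orbit p = (\<lambda>(r, k). orbit (AutoGroup (integer_mod_group (p ^ k))) (\<lambda>f. f) (int p ^ r))"

text \<open>On \<open>fund_poset\<close> the subtractions are not truncated.\<close>

definition fund_le :: "nat \<times> nat \<Rightarrow> nat \<times> nat \<Rightarrow> bool" where
  "fund_le = (\<lambda>(s, l) (r, k). r \<le> s \<and> l - s \<le> k - r)"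

definition fund_poset_part :: "nat list \<Rightarrow> (nat \<times> nat) set" where
  "fund_poset_part lam = {(r, k) \<in> fund_poset. k \<in> set lam}"

definition order_ideal :: "(nat \<times> nat) set \<Rightarrow> (nat \<times> nat) set \<Rightarrow> bool" where
  "order_ideal Q J \<longleftrightarrow> J \<subseteq> Q \<and> (\<forall>x\<in>J. \<forall>y\<in>Q. fund_le y x \<longrightarrow> y \<in> J)"

definition coord_symbols :: "nat \<Rightarrow> nat list \<Rightarrow> (nat \<Rightarrow> int) \<Rightarrow> (nat \<times> nat) set" where
  "coord_symbols p lam a =
     {(r, k) \<in> fund_poset. \<exists>i<length lam. k = lam ! i \<and> a i \<noteq> 0 \<and> a i \<in> symbol_orbit p (r, k)}"

definition elem_ideal :: "nat \<Rightarrow> nat list \<Rightarrow> (nat \<Rightarrow> int) \<Rightarrow> (nat \<times> nat) set" where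
  "elem_ideal p lam a = order_ideal fund_poset hull coord_symbols p lam a"

definition elem_ideal_part :: "nat \<Rightarrow> nat list \<Rightarrow> (nat \<Rightarrow> int) \<Rightarrow> (nat \<times> nat) set" where
  "elem_ideal_part p lam a = elem_ideal p lam a \<inter> fund_poset_part lam"

definition ideal_subgroup :: "nat \<Rightarrow> nat list \<Rightarrow> (nat \<times> nat) set \<Rightarrow> (nat \<Rightarrow> int) set" where
  "ideal_subgroup p lam I = {a \<in> carrier (fin_pgroup p lam). elem_ideal_part p lam a \<subseteq> I}"

definition symbol_mult :: "nat list \<Rightarrow> nat \<times> nat \<Rightarrow> nat" where
  "symbol_mult lam = (\<lambda>(r, k). count_list lam k)"

definition ideal_weight :: "nat list \<Rightarrow> (nat \<times> nat) set \<Rightarrow> nat" where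
  "ideal_weight lam I = (\<Sum>x\<in>I. symbol_mult lam x)"

text \<open>Consequences of the definitions: the orbits are the sets of elements \<open>p\<^sup>r u\<close> with
  \<open>p\<close> not dividing \<open>u\<close>, the relation is a partial order on \<open>fund_poset\<close>, and \<open>elem_ideal\<close> is the
  downward closure of its generators.\<close>

lemma symbol_orbit_eq:
  assumes p: "prime p" and rk: "r < k"
  shows "symbol_orbit p (r, k) = {x \<in> {0..<int p ^ k}. \<exists>u. \<not> int p dvd u \<and> x = int p ^ r * u}"
proof -
  let ?n = "int p ^ k" and ?G = "integer_mod_group (p ^ k)"
  have p1: "1 < int p" using prime_gt_1_nat[OF p] by simp
  have pi: "prime (int p)" using p by simp
  have n1: "1 < ?n" using p1 rk by (simp add: one_less_power)
  have p0: "0 < p" using p1 by simp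
  have car: "carrier ?G = {0..<?n}" using p1 by (auto simp: carrier_integer_mod_group)
  have rn: "int p ^ r \<in> {0..<?n}" using p1 rk by (simp add: power_strict_increasing)
  have hom_lin: "f x = (x * f 1) mod ?n" if f: "f \<in> hom ?G ?G" and x: "x \<in> {0..<?n}" for f x
  proof -
    have g: "group_hom ?G ?G f" using f by (simp add: group_hom_def group_hom_axioms_def)
    have one: "1 \<in> carrier ?G" using n1 car by simp
    have "f (1 [^]\<^bsub>?G\<^esub> x) = f 1 [^]\<^bsub>?G\<^esub> x" using group_hom.hom_int_pow[OF g one] .
    then show ?thesis using x by (simp add: int_pow_integer_mod_group)
  qed
  have orb: "symbol_orbit p (r, k) = {f (int p ^ r) | f. f \<in> auto ?G}"
    by (simp add: symbol_orbit_def orbit_def AutoGroup_def)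
  show ?thesis
  proof (intro Set.set_eqI iffI)
    fix x assume "x \<in> symbol_orbit p (r, k)"
    then obtain f where f: "f \<in> hom ?G ?G" "bij_betw f {0..<?n} {0..<?n}" and x: "x = f (int p ^ r)"
      using orb car by (auto simp: auto_def Bij_def)
    have xin: "x \<in> {0..<?n}" using f(2) rn x by (auto dest: bij_betwE)
    have nd: "\<not> int p dvd f 1"
    proof
      assume "int p dvd f 1"
      then obtain c where c: "f 1 = int p * c" by auto
      have in1: "int p ^ (k - 1) \<in> {0..<?n}" using p1 rk by (simp add: power_strict_increasing)
      have pk: "int p ^ (k - 1) * int p = ?n" using rk by (cases k) auto
      have "int p ^ (k - 1) * f 1 = ?n * c" unfolding c using pk by (metis mult.assoc)
      then have "f (int p ^ (k - 1)) = 0" using hom_lin[OF f(1) in1] by simp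
      moreover have "f 0 = 0" using hom_lin[OF f(1), of 0] p1 by simp
      ultimately have "int p ^ (k - 1) = 0"
        using f(2) in1 n1 by (auto simp: bij_betw_def dest!: inj_onD[of f _ "int p ^ (k - 1)" 0])
      then show False using p1 by simp
    qed
    define q where "q = (int p ^ r * f 1) div ?n"
    have "x = int p ^ r * f 1 - ?n * q"
      using hom_lin[OF f(1) rn] x by (simp add: q_def minus_mult_div_eq_mod)
    moreover have "?n = int p ^ r * (int p * int p ^ (k - r - 1))"
      using rk by (simp flip: power_add power_Suc)
    ultimately have "x = int p ^ r * (f 1 - int p * (int p ^ (k - r - 1) * q))"
      by (simp add: algebra_simps)
    moreover have "\<not> int p dvd f 1 - int p * (int p ^ (k - r - 1) * q)"
      using nd by (metis dvd_diff_right_iff dvd_triv_left dvd_diff_left_iff)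
    ultimately show "x \<in> {x \<in> {0..<?n}. \<exists>u. \<not> int p dvd u \<and> x = int p ^ r * u}"
      using xin by blast
  next
    fix x assume "x \<in> {x \<in> {0..<?n}. \<exists>u. \<not> int p dvd u \<and> x = int p ^ r * u}"
    then obtain u where u: "\<not> int p dvd u" "x = int p ^ r * u" and x: "x \<in> {0..<?n}" by blast
    define f where "f = (\<lambda>y\<in>{0..<?n}. (y * u) mod ?n)"
    have cop: "coprime u ?n"
      using u(1) pi by (metis coprime_commute coprime_power_right_iff prime_imp_coprime)
    have fin: "f ` {0..<?n} \<subseteq> {0..<?n}" using p0 by (auto simp: f_def)
    have inj: "inj_on f {0..<?n}"
    proof (rule inj_onI)
      fix y z assume yz: "y \<in> {0..<?n}" "z \<in> {0..<?n}" "f y = f z"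
      then have "?n dvd (y - z) * u"
        by (simp add: f_def mod_eq_dvd_iff left_diff_distrib)
      then have "?n dvd y - z" using cop by (simp add: coprime_commute coprime_dvd_mult_left_iff)
      then have "y mod ?n = z mod ?n" by (simp add: mod_eq_dvd_iff)
      then show "y = z" using yz by simp
    qed
    have bij: "bij_betw f {0..<?n} {0..<?n}"
      using inj fin by (simp add: bij_betw_def endo_inj_surj)
    have "f \<in> hom ?G ?G"
      using fin p0 by (auto simp: hom_def car f_def mod_simps distrib_right)
    then have "f \<in> auto ?G" using bij by (auto simp: auto_def Bij_def car f_def)
    moreover have "f (int p ^ r) = x" using rn x u(2) by (simp add: f_def)
    ultimately show "x \<in> symbol_orbit p (r, k)" using orb by blast
  qed
qed

lemma fund_le_partial_order:
  "partial_order_on fund_poset {(x, y). x \<in> fund_poset \<and> y \<in> fund_poset \<and> fund_le x y}"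
  by (auto simp: partial_order_on_def preorder_on_def refl_on_def trans_def antisym_def
      fund_poset_def fund_le_def)

lemma fund_le_trans: "fund_le x y \<Longrightarrow> fund_le y z \<Longrightarrow> fund_le x z"
  by (auto simp: fund_le_def)

lemma elem_ideal_eq:
  "elem_ideal p lam a = {y \<in> fund_poset. \<exists>x\<in>coord_symbols p lam a. fund_le y x}"
  unfolding elem_ideal_def
proof (rule hull_unique)
  show "coord_symbols p lam a \<subseteq> {y \<in> fund_poset. \<exists>x\<in>coord_symbols p lam a. fund_le y x}"
    by (auto simp: coord_symbols_def fund_le_def)
  show "order_ideal fund_poset {y \<in> fund_poset. \<exists>x\<in>coord_symbols p lam a. fund_le y x}"
    unfolding order_ideal_def using fund_le_trans by blast
  show "{y \<in> fund_poset. \<exists>x\<in>coord_symbols p lam a. fund_le y x} \<subseteq> J"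
    if "coord_symbols p lam a \<subseteq> J" "order_ideal fund_poset J" for J
    using that by (fastforce simp: order_ideal_def)
qed

end

theory Submission
  imports Defs
begin

text \<open>A down-closed subset of \<open>P\<^sub>\<lambda>\<close> meets the chain of symbols \<open>(p\<^sup>r, k)\<close> with fixed \<open>k\<close> in
  those with \<open>r \<ge> k - c\<close>, where \<open>c\<close> is the number of such symbols in it. Hence membership in
  \<open>A\<^sub>p\<^sub>,\<^sub>I\<close> is a coordinatewise divisibility condition: the coordinate in \<open>\<int>/p\<^sup>k\<close> ranges over the
  multiples of \<open>p\<^bsup>k - c\<^esup>\<close>, of which there are \<open>p\<^sup>c\<close>. The exponents add up to \<open>[I]\<close>.\<close>

text \<open>A nonempty up-closed set is the interval from its minimum to \<open>k\<close>, so its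
  cardinality determines it; for the empty set the interval is empty as well.\<close>

lemma up_closed_lessThan_eq:
  fixes S :: "nat set"
  assumes "S \<subseteq> {..<k}" and up: "\<And>r s. r \<in> S \<Longrightarrow> r \<le> s \<Longrightarrow> s < k \<Longrightarrow> s \<in> S"
  shows "S = {k - card S..<k}"
proof (cases "S = {}")
  case False
  have fin: "finite S" using assms(1) finite_subset by blast
  then have m: "Min S \<in> S" using False by simp
  have "S = {Min S..<k}"
    using assms(1) fin up[OF m] by (fastforce intro: Min_le)
  moreover from this have "card S = k - Min S" by (metis card_atLeastLessThan)
  ultimately show ?thesis using m assms(1) by auto
qed simp

text \<open>Multiplication by \<open>p ^ (k - c)\<close> maps \<open>{0..<p ^ c}\<close> bijectively
  onto these multiples.\<close>

lemma card_multiples_power: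
  fixes p k c :: nat
  assumes "0 < p" "c \<le> k"
  shows "card {x \<in> {0..<int (p ^ k)}. int p ^ (k - c) dvd x} = p ^ c"
proof -
  define q where "q = int p ^ (k - c)"
  have q: "0 < q" using assms by (simp add: q_def)
  have pk: "int (p ^ k) = q * int p ^ c" using assms by (simp add: q_def flip: power_add)
  have "{x \<in> {0..<int (p ^ k)}. q dvd x} = (\<lambda>y. q * y) ` {0..<int p ^ c}"
    unfolding pk using q by (auto simp: zero_le_mult_iff elim!: dvdE)
  moreover have "inj_on (\<lambda>y. q * y) {0..<int p ^ c}" using q by (auto simp: inj_on_def)
  ultimately show ?thesis by (simp add: card_image nat_power_eq flip: q_def)
qed

lemma power_dvd_power_mult_iff:
  fixes p u :: int
  assumes "p \<noteq> 0" "\<not> p dvd u"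
  shows "p ^ n dvd p ^ r * u \<longleftrightarrow> n \<le> r"
proof
  assume d: "p ^ n dvd p ^ r * u"
  show "n \<le> r"
  proof (rule ccontr)
    assume "\<not> n \<le> r"
    \<comment> \<open>Cancelling \<open>p ^ r\<close> from \<open>p ^ Suc r dvd p ^ r * u\<close>
      would leave \<open>p dvd u\<close>.\<close>
    then have "p ^ Suc r dvd p ^ n" by (intro le_imp_power_dvd) simp
    then have "p ^ r * p dvd p ^ r * u" using d by (metis dvd_trans power_Suc2)
    then show False using assms by simp
  qed
qed (simp add: le_imp_power_dvd)

lemma prime_power_decomposition:
  assumes "prime (p :: nat)" "(x :: int) \<noteq> 0"
  obtains r u where "x = int p ^ r * u" "\<not> int p dvd u"
proof -
  have "\<not> is_unit (int p)" using assms(1) by (auto simp: prime_nat_iff)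
  then show thesis using multiplicity_decompose'[OF assms(2)] that by metis
qed

text \<open>The generators lie in P_lambda and \<open>I\<close> is down-closed there, so containment
  need only be tested on generators.\<close>

lemma elem_ideal_part_subset_iff:
  assumes "order_ideal (fund_poset_part lam) I"
  shows "elem_ideal_part p lam a \<subseteq> I \<longleftrightarrow> coord_symbols p lam a \<subseteq> I"
proof
  assume "elem_ideal_part p lam a \<subseteq> I"
  moreover have "coord_symbols p lam a \<subseteq> elem_ideal_part p lam a"
    by (auto simp: elem_ideal_part_def elem_ideal_eq coord_symbols_def fund_poset_part_def
        fund_le_def)
  ultimately show "coord_symbols p lam a \<subseteq> I" by blast
next
  assume "coord_symbols p lam a \<subseteq> I"
  then show "elem_ideal_part p lam a \<subseteq> I"
    using assms by (auto simp: elem_ideal_part_def elem_ideal_eq order_ideal_def)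
qed

text \<open>For fixed \<open>k\<close>, raising \<open>r\<close> lowers the symbol in the order, so
  a section of a down-closed set is up-closed in \<open>r\<close>.\<close>

lemma order_ideal_part_section:
  assumes "order_ideal (fund_poset_part lam) I"
  shows "{r. (r, k) \<in> I} = {k - card {r. (r, k) \<in> I}..<k}"
proof (rule up_closed_lessThan_eq)
  show "{r. (r, k) \<in> I} \<subseteq> {..<k}"
    using assms by (auto simp: order_ideal_def fund_poset_part_def fund_poset_def)
  show "s \<in> {r. (r, k) \<in> I}" if "r \<in> {r. (r, k) \<in> I}" "r \<le> s" "s < k" for r s
  proof -
    have "(s, k) \<in> fund_poset_part lam" "fund_le (s, k) (r, k)"
      using assms that by (auto simp: order_ideal_def fund_poset_part_def fund_poset_def fund_le_def)
    then show ?thesis using assms that(1) by (auto simp: order_ideal_def)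
  qed
qed

lemma ideal_subgroup_eq_PiE:
  assumes p: "prime p" and I: "order_ideal (fund_poset_part lam) I"
  shows "ideal_subgroup p lam I =
    (\<Pi>\<^sub>E i\<in>{..<length lam}. {x \<in> {0..<int (p ^ (lam ! i))}.
       int p ^ (lam ! i - card {r. (r, lam ! i) \<in> I}) dvd x})"
proof -
  have p0: "0 < p" using p by (rule prime_gt_0_nat)
  have car: "carrier (fin_pgroup p lam) = (\<Pi>\<^sub>E i\<in>{..<length lam}. {0..<int (p ^ (lam ! i))})"
    using p0 by (auto simp: fin_pgroup_def carrier_integer_mod_group intro!: PiE_cong)
  define c where "c k = card {r. (r, k) \<in> I}" for k
  have sec: "(r, k) \<in> I \<longleftrightarrow> k - c k \<le> r \<and> r < k" for r k
    using order_ideal_part_section[OF I, of k] by (auto simp: c_def)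
  have "coord_symbols p lam a \<subseteq> I \<longleftrightarrow>
      (\<forall>i<length lam. int p ^ (lam ! i - c (lam ! i)) dvd a i)"
    if a: "a \<in> carrier (fin_pgroup p lam)" for a
  proof (intro iffI allI impI)
    fix i assume sub: "coord_symbols p lam a \<subseteq> I" and i: "i < length lam"
    let ?k = "lam ! i"
    have ai: "a i \<in> {0..<int p ^ ?k}" using a i by (auto simp: car PiE_iff)
    show "int p ^ (?k - c ?k) dvd a i"
    proof (cases "a i = 0")
      case False
      obtain r u where ru: "a i = int p ^ r * u" "\<not> int p dvd u"
        using prime_power_decomposition[OF p False] by blast
      have "r < ?k"
      proof (rule ccontr)
        \<comment> \<open>A nonzero representative below \<open>p ^ ?k\<close> cannot be divisible
          by \<open>p ^ ?k\<close>.\<close>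
        assume "\<not> r < ?k"
        then have "int p ^ ?k dvd a i" using ru(1) by (simp add: le_imp_power_dvd)
        then show False using ai False zdvd_imp_le by fastforce
      qed
      then have "(r, ?k) \<in> coord_symbols p lam a"
        using ru ai i False symbol_orbit_eq[OF p \<open>r < ?k\<close>]
        by (auto simp: coord_symbols_def fund_poset_def)
      then have "?k - c ?k \<le> r" using sub sec by blast
      then show ?thesis using ru(1) by (simp add: le_imp_power_dvd)
    qed simp
  next
    assume dv: "\<forall>i<length lam. int p ^ (lam ! i - c (lam ! i)) dvd a i"
    show "coord_symbols p lam a \<subseteq> I"
    proof safe
      fix r k assume "(r, k) \<in> coord_symbols p lam a"
      then obtain i where i: "i < length lam" "k = lam ! i" "a i \<in> symbol_orbit p (r, k)"
        and rk: "r < k" by (auto simp: coord_symbols_def fund_poset_def)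
      obtain u where u: "\<not> int p dvd u" "a i = int p ^ r * u"
        using i(3) symbol_orbit_eq[OF p rk] by auto
      have "int p ^ (k - c k) dvd int p ^ r * u" using dv i(1,2) u(2) by auto
      then show "(r, k) \<in> I" using sec rk u(1) p0 by (simp add: power_dvd_power_mult_iff)
    qed
  qed
  then have "ideal_subgroup p lam I = {a \<in> carrier (fin_pgroup p lam).
      \<forall>i<length lam. int p ^ (lam ! i - c (lam ! i)) dvd a i}"
    unfolding ideal_subgroup_def elem_ideal_part_subset_iff[OF I]
    by blast
  \<comment> \<open>The conditions concern one coordinate each, so they cut out a product of subsets
    of the factors.\<close>
  then show ?thesis unfolding c_def car by (auto simp: PiE_iff extensional_def)
qed

text \<open>Double counting of the pairs of a symbol \<open>(r, k)\<close> in \<open>I\<close> and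
  an index \<open>i\<close> with \<open>lam ! i = k\<close>: the multiplicity of a symbol is its
  number of such indices.\<close>

lemma ideal_weight_eq_sum_card:
  assumes "order_ideal (fund_poset_part lam) I"
  shows "ideal_weight lam I = (\<Sum>i<length lam. card {r. (r, lam ! i) \<in> I})"
proof -
  have "I \<subseteq> (\<Union>k\<in>set lam. {..<k} \<times> {k})"
    using assms by (auto simp: order_ideal_def fund_poset_part_def fund_poset_def)
  then have fin: "finite I" by (rule finite_subset) auto
  have count: "symbol_mult lam x = (\<Sum>i<length lam. if snd x = lam ! i then 1 else 0)" for x
  proof -
    have "symbol_mult lam x = card {i \<in> {..<length lam}. snd x = lam ! i}"
      by (simp add: symbol_mult_def case_prod_beta count_list_eq_length_filter length_filter_conv_card)
    also have "\<dots> = (\<Sum>i<length lam. if snd x = lam ! i then 1 else 0)"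
      by (simp add: sum.If_cases Int_def)
    finally show ?thesis .
  qed
  have sec: "card {x \<in> I. snd x = k} = card {r. (r, k) \<in> I}" for k
  proof -
    have "{x \<in> I. snd x = k} = (\<lambda>r. (r, k)) ` {r. (r, k) \<in> I}" by auto
    then show ?thesis by (simp add: card_image inj_on_def)
  qed
  have "ideal_weight lam I = (\<Sum>i<length lam. \<Sum>x\<in>I. if snd x = lam ! i then 1 else 0)"
    unfolding ideal_weight_def count by (rule sum.swap)
  also have "\<dots> = (\<Sum>i<length lam. card {x \<in> I. snd x = lam ! i})"
    using fin by (simp add: sum.If_cases Int_def)
  finally show ?thesis by (simp add: sec)
qed

theorem theorem7p3:
  fixes p :: nat and lam :: "nat list" and I :: "(nat \<times> nat) set"
  assumes "prime p"
    and "is_partition lam"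
    and "order_ideal (fund_poset_part lam) I"
  shows "card (ideal_subgroup p lam I) = p ^ ideal_weight lam I"
proof -
  \<comment> \<open>This bound keeps \<open>k - card {r. (r, k) \<in> I}\<close> from being
    truncated, as the count of multiples requires.\<close>
  have "card {r. (r, k) \<in> I} \<le> k" for k
    using order_ideal_part_section[OF assms(3), of k] by (metis card_atLeastLessThan diff_le_self)
  then have "card {x \<in> {0..<int (p ^ k)}. int p ^ (k - card {r. (r, k) \<in> I}) dvd x} =
      p ^ card {r. (r, k) \<in> I}" for k
    using assms(1) by (intro card_multiples_power) (simp_all add: prime_gt_0_nat)
  then show ?thesis
    unfolding ideal_subgroup_eq_PiE[OF assms(1,3)] ideal_weight_eq_sum_card[OF assms(3)]
    by (simp add: card_PiE power_sum)
qed

end
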